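(* Let $K,n\ge 1$ be integers, let $\nu_1,\dots,\nu_K$ be probability distributions supported on $[0,1]$, let $D=[0,1]\times[0,1]$, let $f:D\to\mathbb{R}$ be continuous, and let $\varphi:\mathbb{R}_+\to\mathbb{R}_+$ be a strictly increasing function with $\varphi(0)=0$ and $|f(\mathbf{x}_2)-f(\mathbf{x}_1)|\le\varphi(\|\mathbf{x}_2-\mathbf{x}_1\|_1)$ for all $\mathbf{x}_1,\mathbf{x}_2\in D$. Let $f_i=f(\mu_i,\sigma_i^2)$, where $\mu_i,\sigma_i^2$ are the mean and variance of $\nu_i$, let $i^\star\in\operatorname{argmin}_{i}f_i$, and let $\Delta_i=f_i-f_{i^\star}$. Then for every $\delta\in(0,\frac{1}{4Kn})$, with probability at least $1-4Kn\delta$, the regret $\mathcal{R}_n$ at time $n$ of the $\varphi$-LCB algorithm run with confidence level $\delta$ satisfies \[ \mathcal{R}_n\le\sum_{i:\Delta_i>0}\frac{18\,\Delta_i\,\ln\frac1\delta}{(\varphi^{-1}(\Delta_i/2))^2}+\sum_{i:\Delta_i>0}\Delta_i . \] Moreover, if $n>4K$ and the algorithm is run with $\delta=\frac1{n^2}$, then with probability at least $1-\frac{4K}{n}$, \[ \mathcal{R}_n\le\sum_{i:\Delta_i>0}\frac{36\,\Delta_i}{(\varphi^{-1}(\Delta_i/2))^2}\ln n+\sum_{i:\Delta_i>0}\Delta_i . \]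
   Context: Stochastic bandit setting. There are $K$ arms with distributions $\nu_1,\dots,\nu_K$ on $[0,1]$. For each arm $i$, $X_{i,1},X_{i,2},\dots$ are i.i.d. samples from $\nu_i$. At each time step $t=1,\dots,n$ the learner chooses an arm $a_t\in\{1,\dots,K\}$ based on past observations and observes $X_{a_t,T_{a_t}(t)}$, where $T_i(t)=\sum_{s=1}^{t}\mathbb{I}[a_s=i]$ is the number of pulls of arm $i$ up to and including time $t$. Regret: $\mathcal{R}_n=\sum_{t=1}^n f_{a_t}-n f_{i^\star}$, a random variable. Empirical mean and variance of arm $i$ after $t\ge1$ pulls: \[ \widehat\mu_{i,t}=\frac1t\sum_{s=1}^tX_{i,s},\qquad \widehat\sigma^2_{i,t}=\frac1t\sum_{s=1}^t(X_{i,s}-\widehat\mu_{i,t})^2 . \] The $\varphi$-LCB algorithm with confidence level $\delta$ chooses, at each $t=1,\dots,n$, \[ a_t\in\operatorname{argmin}_{i=1,\dots,K}\left[f\big(\widehat\mu_{i,T_i(t-1)},\widehat\sigma^2_{i,T_i(t-1)}\big)-\varphi\left(6\sqrt{\frac{\ln\frac1\delta}{2\,T_i(t-1)}}\right)\right], \] with ties broken arbitrarily. The index of an arm with $T_i(t-1)=0$ is taken to be $-\infty$, so arms not yet pulled are chosen first. Inverse of $\varphi$: for $y>0$, $\varphi^{-1}(y)=\inf\{z\ge0:\varphi(z)\ge y\}$, which is the ordinary inverse whenever $y$ is in the range of $\varphi$. A term with $\varphi^{-1}(\Delta_i/2)=0$ is read as $+\infty$. $\mathbb{R}_+=[0,\infty)$.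 *)

theory Defs
  imports "HOL-Probability.Probability"
begin

(* Arms are numbered 1..K and rounds 1..n; X i s is the s-th sample of arm i (s \<ge> 1), and a t is
   the arm chosen in round t.  Functions on pairs (mean, variance) are total in HOL; only their
   values on [0,1] x [0,1] matter. *)

definition l1_norm :: "real \<times> real \<Rightarrow> real" where
  "l1_norm x = \<bar>fst x\<bar> + \<bar>snd x\<bar>"

definition arm_mean :: "real measure \<Rightarrow> real" where
  "arm_mean N = (LINT x|N. x)"

definition arm_var :: "real measure \<Rightarrow> real" where
  "arm_var N = (LINT x|N. (x - arm_mean N)\<^sup>2)"

definition arm_value :: "(real \<times> real \<Rightarrow> real) \<Rightarrow> (nat \<Rightarrow> real measure) \<Rightarrow> nat \<Rightarrow> real" where
  "arm_value f \<nu> i = f (arm_mean (\<nu> i), arm_var (\<nu> i))"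

definition gap :: "(real \<times> real \<Rightarrow> real) \<Rightarrow> (nat \<Rightarrow> real measure) \<Rightarrow> nat \<Rightarrow> nat \<Rightarrow> real" where
  "gap f \<nu> istar i = arm_value f \<nu> i - arm_value f \<nu> istar"

definition pulls :: "(nat \<Rightarrow> 'a \<Rightarrow> nat) \<Rightarrow> nat \<Rightarrow> nat \<Rightarrow> 'a \<Rightarrow> nat" where
  "pulls a i t \<omega> = (\<Sum>s=1..t. of_bool (a s \<omega> = i))"

definition emp_mean :: "(nat \<Rightarrow> nat \<Rightarrow> 'a \<Rightarrow> real) \<Rightarrow> nat \<Rightarrow> nat \<Rightarrow> 'a \<Rightarrow> real" where
  "emp_mean X i t \<omega> = (1 / real t) * (\<Sum>s=1..t. X i s \<omega>)"

definition emp_var :: "(nat \<Rightarrow> nat \<Rightarrow> 'a \<Rightarrow> real) \<Rightarrow> nat \<Rightarrow> nat \<Rightarrow> 'a \<Rightarrow> real" where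
  "emp_var X i t \<omega> = (1 / real t) * (\<Sum>s=1..t. (X i s \<omega> - emp_mean X i t \<omega>)\<^sup>2)"

(* Index of an arm that has been pulled m times so far. *)
definition lcb_index ::
  "(real \<times> real \<Rightarrow> real) \<Rightarrow> (real \<Rightarrow> real) \<Rightarrow> real \<Rightarrow> (nat \<Rightarrow> nat \<Rightarrow> 'a \<Rightarrow> real) \<Rightarrow>
    nat \<Rightarrow> nat \<Rightarrow> 'a \<Rightarrow> ereal" where
  "lcb_index f \<phi> \<delta> X i m \<omega> =
    (if m = 0 then - \<infinity>
     else ereal (f (emp_mean X i m \<omega>, emp_var X i m \<omega>)
                 - \<phi> (6 * sqrt (ln (1 / \<delta>) / (2 * real m)))))"

(* A run is any process of choices that is optimal for the indices in every round.  The indices in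
   round t involve only earlier choices and the samples seen before round t, so the choices can
   depend on anything else only through the tie-breaking, which is arbitrary (and may be
   randomised); it is merely required to be measurable. *)
definition phi_lcb_run ::
  "'a measure \<Rightarrow> nat \<Rightarrow> nat \<Rightarrow> (real \<times> real \<Rightarrow> real) \<Rightarrow> (real \<Rightarrow> real) \<Rightarrow> real \<Rightarrow>
    (nat \<Rightarrow> nat \<Rightarrow> 'a \<Rightarrow> real) \<Rightarrow> (nat \<Rightarrow> 'a \<Rightarrow> nat) \<Rightarrow> bool" where
  "phi_lcb_run M K n f \<phi> \<delta> X a \<longleftrightarrow>
    (\<forall>t\<in>{1..n}. a t \<in> measurable M (count_space UNIV) \<and>
      (\<forall>\<omega>\<in>space M.
        is_arg_min (\<lambda>i. lcb_index f \<phi> \<delta> X i (pulls a i (t - 1) \<omega>) \<omega>)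
          (\<lambda>i. i \<in> {1..K}) (a t \<omega>)))"

definition regret ::
  "(real \<times> real \<Rightarrow> real) \<Rightarrow> (nat \<Rightarrow> real measure) \<Rightarrow> nat \<Rightarrow> (nat \<Rightarrow> 'a \<Rightarrow> nat) \<Rightarrow> nat \<Rightarrow> 'a \<Rightarrow> real" where
  "regret f \<nu> istar a n \<omega> =
    (\<Sum>t=1..n. arm_value f \<nu> (a t \<omega>)) - real n * arm_value f \<nu> istar"

(* Meant for y > 0 such that some z \<ge> 0 has \<phi> z \<ge> y.  This holds when y is half of a gap,
   because gaps are differences of values of f on [0,1] x [0,1] and so bounded by values of \<phi>. *)
definition phi_inv :: "(real \<Rightarrow> real) \<Rightarrow> real \<Rightarrow> real" where
  "phi_inv \<phi> y = Inf {z. 0 \<le> z \<and> y \<le> \<phi> z}"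

end

theory Submission
  imports Defs
begin

text \<open>
  On the event that for every arm \<open>i\<close> and every sample size \<open>m \<le> n\<close> both the empirical mean of the
  samples and the empirical mean of the squared deviations from the true mean are within
  \<open>\<epsilon> = sqrt (ln (1 / \<delta>) / (2 m))\<close> of their expectations, the pair of empirical mean and variance is
  within \<open>3 \<epsilon>\<close> of the true pair in the \<open>1\<close>-norm.  By Hoeffding's inequality and a union bound this
  event has probability at least \<open>1 - 4 K n \<delta>\<close>.  On it the index of the best arm is at most its
  value, so an arm \<open>i\<close> chosen after \<open>m\<close> pulls satisfies \<open>\<Delta>\<^sub>i \<le> \<phi> (3 \<epsilon>) + \<phi> (6 \<epsilon>) \<le> 2 \<phi> (6 \<epsilon>)\<close>,
  which bounds \<open>m\<close> by \<open>18 ln (1 / \<delta>) / (\<phi>\<^sup>-\<^sup>1 (\<Delta>\<^sub>i / 2))\<^sup>2\<close>.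
\<close>

text \<open>The radius at which the Hoeffding exponential \<open>exp (- 2 * m * r\<^sup>2)\<close>
  for \<open>m \<ge> 1\<close> variables in the unit interval equals \<open>\<delta>\<close>. The
  exploration term of the index is \<open>\<phi>\<close> at six times this radius.\<close>

definition conf_radius :: "real \<Rightarrow> nat \<Rightarrow> real" where
  "conf_radius \<delta> m = sqrt (ln (1 / \<delta>) / (2 * real m))"

text \<open>The squares are centred at the true mean, not at the empirical one: this keeps the
  summands independent, so that Hoeffding's inequality applies to both averages.\<close>

definition concentrated ::
  "real \<Rightarrow> (nat \<Rightarrow> nat \<Rightarrow> 'a \<Rightarrow> real) \<Rightarrow> real measure \<Rightarrow> nat \<Rightarrow> nat \<Rightarrow> 'a \<Rightarrow> bool" where
  "concentrated \<epsilon> X N i m \<omega> \<longleftrightarrow>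
     \<bar>emp_mean X i m \<omega> - arm_mean N\<bar> \<le> \<epsilon> \<and>
     \<bar>(1 / real m) * (\<Sum>s=1..m. (X i s \<omega> - arm_mean N)\<^sup>2) - arm_var N\<bar> \<le> \<epsilon>"

section \<open>Empirical mean and variance\<close>

text \<open>The parallel axis identity. With \<open>c\<close> the true mean it replaces the
  empirical variance by an average of independent terms and a correction that is quadratic in the
  error of the mean.\<close>

lemma emp_var_shift:
  assumes "m \<ge> 1"
  shows "emp_var X i m \<omega> =
    (1 / real m) * (\<Sum>s=1..m. (X i s \<omega> - c)\<^sup>2) - (emp_mean X i m \<omega> - c)\<^sup>2"
proof -
  let ?e = "emp_mean X i m \<omega>"
  have S: "(\<Sum>s=1..m. X i s \<omega>) = real m * ?e"
    using assms by (simp add: emp_mean_def)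
  \<comment> \<open>The difference of the two squares is affine in \<open>X i s \<omega>\<close>, so
    its sum depends only on the total \<open>m * ?e\<close>.\<close>
  have "(\<Sum>s=1..m. (X i s \<omega> - ?e)\<^sup>2) =
      (\<Sum>s=1..m. (X i s \<omega> - c)\<^sup>2 + 2 * (c - ?e) * X i s \<omega> + (?e\<^sup>2 - c\<^sup>2))"
    by (intro sum.cong) (auto simp: power2_eq_square algebra_simps)
  also have "\<dots> = (\<Sum>s=1..m. (X i s \<omega> - c)\<^sup>2) + 2 * (c - ?e) * (real m * ?e) + real m * (?e\<^sup>2 - c\<^sup>2)"
    unfolding S[symmetric] by (simp add: sum.distrib sum_distrib_left)
  also have "\<dots> = (\<Sum>s=1..m. (X i s \<omega> - c)\<^sup>2) - real m * (?e - c)\<^sup>2"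
    by (simp add: power2_eq_square algebra_simps)
  finally have "emp_var X i m \<omega> = (1 / real m) * ((\<Sum>s=1..m. (X i s \<omega> - c)\<^sup>2) - real m * (?e - c)\<^sup>2)"
    by (simp only: emp_var_def)
  then show ?thesis
    using assms by (simp add: field_simps)
qed

lemma average_in_unit:
  fixes x :: "nat \<Rightarrow> real"
  assumes "\<And>s. s \<in> {1..m} \<Longrightarrow> x s \<in> {0..1}"
  shows "(1 / real m) * (\<Sum>s=1..m. x s) \<in> {0..1}"
proof -
  have "(\<Sum>s=1..m. x s) \<le> (\<Sum>s=1..m. 1)"
    using assms by (intro sum_mono) auto
  moreover have "0 \<le> (\<Sum>s=1..m. x s)"
    using assms by (intro sum_nonneg) auto
  \<comment> \<open>For \<open>m = 0\<close> the average is 0, because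
    \<open>1 / 0 = 0\<close>.\<close>
  ultimately show ?thesis
    by (cases "m = 0") (auto simp: field_simps)
qed

lemma diff_square_in_unit:
  fixes x y :: real
  assumes "x \<in> {0..1}" "y \<in> {0..1}"
  shows "(x - y)\<^sup>2 \<in> {0..1}"
  using assms abs_square_le_1[of "x - y"] by auto

text \<open>Needed because \<open>f\<close> is controlled by \<open>\<phi>\<close> only on the unit
  square.\<close>

lemma emp_pair_in_unit:
  assumes "\<And>s. s \<in> {1..m} \<Longrightarrow> X i s \<omega> \<in> {0..1}"
  shows "(emp_mean X i m \<omega>, emp_var X i m \<omega>) \<in> {0..1} \<times> {0..1}"
proof -
  have e: "emp_mean X i m \<omega> \<in> {0..1}"
    unfolding emp_mean_def by (intro average_in_unit assms)
  moreover have "emp_var X i m \<omega> \<in> {0..1}"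
    unfolding emp_var_def by (intro average_in_unit diff_square_in_unit assms e)
  ultimately show ?thesis by blast
qed

text \<open>One \<open>\<epsilon>\<close> comes from the mean, one from the centred squares, and one
  from the correction \<open>?d\<^sup>2\<close>, which is at most \<open>\<bar>?d\<bar>\<close>
  because both means lie in the unit interval.\<close>

lemma l1_norm_emp_le:
  assumes c: "concentrated \<epsilon> X N i m \<omega>" and m: "m \<ge> 1"
    and X: "\<And>s. s \<in> {1..m} \<Longrightarrow> X i s \<omega> \<in> {0..1}"
    and \<mu>: "arm_mean N \<in> {0..1}"
  shows "l1_norm ((emp_mean X i m \<omega>, emp_var X i m \<omega>) - (arm_mean N, arm_var N)) \<le> 3 * \<epsilon>"
proof -
  let ?d = "emp_mean X i m \<omega> - arm_mean N"
  have e: "emp_mean X i m \<omega> \<in> {0..1}"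
    using emp_pair_in_unit[of m X i \<omega>] X by auto
  have "\<bar>?d\<bar> \<le> 1"
    using e \<mu> by auto
  then have "?d\<^sup>2 \<le> \<bar>?d\<bar>"
    using mult_left_le[of "\<bar>?d\<bar>" "\<bar>?d\<bar>"] by (simp add: power2_eq_square)
  then show ?thesis
    using c emp_var_shift[OF m, of X i \<omega> "arm_mean N"] zero_le_power2[of ?d]
    unfolding concentrated_def l1_norm_def fst_diff snd_diff fst_conv snd_conv by linarith
qed

section \<open>Concentration\<close>

text \<open>Hoeffding's inequality for sums, rescaled by \<open>m\<close>. The strict inequality
  describes the complement of the closed condition in \<open>concentrated\<close>.\<close>

lemma (in prob_space) Hoeffding_average:
  assumes indep: "indep_vars (\<lambda>_. borel) Y {1..}"
    and bnd: "\<And>s. s \<ge> 1 \<Longrightarrow> AE \<omega> in M. Y s \<omega> \<in> {0..1::real}"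
    and E: "\<And>s. s \<ge> (1::nat) \<Longrightarrow> expectation (Y s) = c"
    and m: "m \<ge> 1" and \<epsilon>: "\<epsilon> \<ge> 0"
  shows "prob {\<omega> \<in> space M. \<bar>(1 / real m) * (\<Sum>s=1..m. Y s \<omega>) - c\<bar> > \<epsilon>}
    \<le> 2 * exp (- 2 * real m * \<epsilon>\<^sup>2)"
proof -
  interpret Hoeffding_ineq M "{1..m}" Y "\<lambda>_. 0" "\<lambda>_. 1" "\<Sum>s\<in>{1..m}. expectation (Y s)"
    by unfold_locales (use bnd in \<open>auto intro: indep_vars_subset[OF indep]\<close>)
  have Esum: "(\<Sum>s\<in>{1..m}. expectation (Y s)) = real m * c"
    by (simp add: E)
  have "prob {\<omega> \<in> space M. \<bar>(1 / real m) * (\<Sum>s=1..m. Y s \<omega>) - c\<bar> > \<epsilon>}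
      \<le> prob {\<omega> \<in> space M. \<bar>(\<Sum>s=1..m. Y s \<omega>) - (\<Sum>s\<in>{1..m}. expectation (Y s))\<bar> \<ge> real m * \<epsilon>}"
  proof (intro finite_measure_mono subsetI)
    fix \<omega> assume "\<omega> \<in> {\<omega> \<in> space M. \<bar>(1 / real m) * (\<Sum>s=1..m. Y s \<omega>) - c\<bar> > \<epsilon>}"
    then have *: "\<omega> \<in> space M" "\<bar>(1 / real m) * (\<Sum>s=1..m. Y s \<omega>) - c\<bar> > \<epsilon>"
      by auto
    have "(\<Sum>s=1..m. Y s \<omega>) - real m * c = real m * ((1 / real m) * (\<Sum>s=1..m. Y s \<omega>) - c)"
      using m by (simp add: field_simps)
    then have "\<bar>(\<Sum>s=1..m. Y s \<omega>) - real m * c\<bar> = real m * \<bar>(1 / real m) * (\<Sum>s=1..m. Y s \<omega>) - c\<bar>"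
      by (simp only: abs_mult abs_of_nat)
    with * show "\<omega> \<in> {\<omega> \<in> space M. \<bar>(\<Sum>s=1..m. Y s \<omega>) - (\<Sum>s\<in>{1..m}. expectation (Y s))\<bar> \<ge> real m * \<epsilon>}"
      unfolding Esum by (auto intro: mult_left_mono)
  qed measurable
  \<comment> \<open>Each summand ranges over an interval of length 1, so the denominator is
    \<open>m\<close> and cancels one factor of \<open>m\<^sup>2\<close>.\<close>
  also have "\<dots> \<le> 2 * exp (- 2 * (real m * \<epsilon>)\<^sup>2 / (\<Sum>s\<in>{1..m}. (1 - 0)\<^sup>2))"
    by (rule Hoeffding_ineq_abs_ge) (use m \<epsilon> in auto)
  also have "- 2 * (real m * \<epsilon>)\<^sup>2 / (\<Sum>s\<in>{1..m}. (1 - 0)\<^sup>2) = - 2 * real m * \<epsilon>\<^sup>2"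
    using m by (simp add: power2_eq_square)
  finally show ?thesis .
qed

text \<open>On a probability space, an integrand that is almost surely in the unit interval has its
  integral there. The claim for the mean is used to bound the integrand of the variance.\<close>

lemma (in real_distribution) arm_mean_var_in_unit:
  assumes "prob {0..1} = 1"
  shows "arm_mean M \<in> {0..1}" "arm_var M \<in> {0..1}"
proof -
  have AE: "AE x in M. x \<in> {0..1::real}"
    using AE_prob_1[OF assms] by simp
  have unit: "(\<integral>x. g x \<partial>M) \<in> {0..1}"
    if [measurable]: "g \<in> borel_measurable M" and g: "AE x in M. g x \<in> {0..1}" for g :: "real \<Rightarrow> real"
  proof -
    have g': "AE x in M. 0 \<le> g x" "AE x in M. g x \<le> 1"
      using g by auto
    have "integrable M g"
      by (rule integrable_const_bound[where B = 1]) (use g in auto)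
    then have "(\<integral>x. g x \<partial>M) \<le> (\<integral>x. 1 \<partial>M)"
      by (intro integral_mono_AE) (use g' in auto)
    also have "(\<integral>x. 1 \<partial>M) = (1 :: real)"
      using prob_space by simp
    finally show ?thesis
      using integral_nonneg_AE[OF g'(1)] by simp
  qed
  show *: "arm_mean M \<in> {0..1}"
    unfolding arm_mean_def by (rule unit) (use AE in auto)
  show "arm_var M \<in> {0..1}"
    unfolding arm_var_def
  proof (rule unit)
    show "AE x in M. (x - arm_mean M)\<^sup>2 \<in> {0..1}"
      using AE by eventually_elim (rule diff_square_in_unit[OF _ *])
  qed auto
qed

text \<open>Each of the two averages fails with probability at most \<open>2 * \<delta>\<close> by
  the two-sided Hoeffding bound. The samples lie in the unit interval only almost surely, since just
  their distribution is prescribed.\<close>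

lemma (in prob_space) prob_not_concentrated:
  assumes N: "real_distribution N" "measure N {0..1} = 1"
    and indep: "indep_vars (\<lambda>_. borel) (X i) {1..}"
    and distr: "\<And>s. s \<ge> 1 \<Longrightarrow> distr M borel (X i s) = N"
    and m: "m \<ge> 1" and \<delta>: "0 < \<delta>" "\<delta> < 1"
  shows "{\<omega> \<in> space M. \<not> concentrated (conf_radius \<delta> m) X N i m \<omega>} \<in> events"
    and "prob {\<omega> \<in> space M. \<not> concentrated (conf_radius \<delta> m) X N i m \<omega>} \<le> 4 * \<delta>"
    and "\<And>s. s \<ge> 1 \<Longrightarrow> AE \<omega> in M. X i s \<omega> \<in> {0..1}"
proof -
  interpret N: real_distribution N by fact
  let ?\<epsilon> = "conf_radius \<delta> m" and ?\<mu> = "arm_mean N"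
  have X[measurable]: "X i s \<in> borel_measurable M" if "s \<ge> 1" for s
    using indep that unfolding indep_vars_def by auto
  have \<mu>: "?\<mu> \<in> {0..1}"
    by (rule N.arm_mean_var_in_unit) fact
  show AE: "AE \<omega> in M. X i s \<omega> \<in> {0..1}" if "s \<ge> 1" for s
  proof -
    have "AE x in distr M borel (X i s). x \<in> {0..1}"
      unfolding distr[OF that] using N.AE_prob_1[OF N(2)] by simp
    then show ?thesis
      using X[OF that] by (subst (asm) AE_distr_iff) auto
  qed
  have L: "0 \<le> ln (1 / \<delta>) / (2 * real m)"
    using \<delta> by simp
  then have \<epsilon>: "?\<epsilon> \<ge> 0" and "?\<epsilon>\<^sup>2 = ln (1 / \<delta>) / (2 * real m)"
    unfolding conf_radius_def by (auto simp only: real_sqrt_ge_zero real_sqrt_pow2)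
  then have exp_\<epsilon>: "exp (- 2 * real m * ?\<epsilon>\<^sup>2) = \<delta>"
    using m \<delta> by (simp add: ln_div)
  let ?A = "{\<omega> \<in> space M. \<bar>(1 / real m) * (\<Sum>s=1..m. X i s \<omega>) - ?\<mu>\<bar> > ?\<epsilon>}"
  let ?B = "{\<omega> \<in> space M. \<bar>(1 / real m) * (\<Sum>s=1..m. (X i s \<omega> - ?\<mu>)\<^sup>2) - arm_var N\<bar> > ?\<epsilon>}"
  have "prob ?A \<le> 2 * exp (- 2 * real m * ?\<epsilon>\<^sup>2)"
  proof (rule Hoeffding_average[OF indep AE])
    show "expectation (X i s) = ?\<mu>" if "s \<ge> 1" for s
      using that integral_distr[OF X[OF that], of "\<lambda>x. x"] distr[OF that]
      by (simp add: arm_mean_def)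
  qed (use m \<epsilon> in auto)
  then have A: "prob ?A \<le> 2 * \<delta>"
    by (simp only: exp_\<epsilon>)
  have "prob ?B \<le> 2 * exp (- 2 * real m * ?\<epsilon>\<^sup>2)"
  proof (rule Hoeffding_average)
    \<comment> \<open>Each square is a fixed function of a single sample, so independence carries
      over.\<close>
    show "indep_vars (\<lambda>_. borel) (\<lambda>s \<omega>. (X i s \<omega> - ?\<mu>)\<^sup>2) {1..}"
      by (rule indep_vars_compose2[OF indep]) measurable
    show "AE \<omega> in M. (X i s \<omega> - ?\<mu>)\<^sup>2 \<in> {0..1}" if "s \<ge> 1" for s
      using AE[OF that] by eventually_elim (rule diff_square_in_unit[OF _ \<mu>])
    show "expectation (\<lambda>\<omega>. (X i s \<omega> - ?\<mu>)\<^sup>2) = arm_var N" if "s \<ge> 1" for s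
      using that integral_distr[OF X[OF that], of "\<lambda>x. (x - ?\<mu>)\<^sup>2"] distr[OF that]
      by (simp add: arm_var_def)
  qed (use m \<epsilon> in auto)
  then have B: "prob ?B \<le> 2 * \<delta>"
    by (simp only: exp_\<epsilon>)
  have eq: "{\<omega> \<in> space M. \<not> concentrated ?\<epsilon> X N i m \<omega>} = ?A \<union> ?B"
    by (auto simp: concentrated_def emp_mean_def)
  have ms: "?A \<in> events" "?B \<in> events"
    by measurable
  then show "{\<omega> \<in> space M. \<not> concentrated ?\<epsilon> X N i m \<omega>} \<in> events"
    unfolding eq by blast
  show "prob {\<omega> \<in> space M. \<not> concentrated ?\<epsilon> X N i m \<omega>} \<le> 4 * \<delta>"
    unfolding eq using measure_Un_le[OF ms] A B by linarith
qed

section \<open>Counting pulls\<close>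

lemma pulls_Suc: "pulls a i (Suc t) \<omega> = pulls a i t \<omega> + of_bool (a (Suc t) \<omega> = i)"
  by (simp add: pulls_def)

text \<open>Just before the last choice of \<open>i\<close> the count is at most \<open>B\<close>,
  and that choice adds one. This extra pull is the source of the second sum in the regret
  bound.\<close>

lemma pulls_le:
  assumes "B \<ge> 0"
    and "\<And>t. t \<in> {1..n} \<Longrightarrow> a t \<omega> = i \<Longrightarrow> real (pulls a i (t - 1) \<omega>) \<le> B"
  shows "real (pulls a i n \<omega>) \<le> B + 1"
  using assms
proof (induction n)
  case 0
  then show ?case by (simp add: pulls_def)
next
  case (Suc n)
  have "real (pulls a i n \<omega>) \<le> B + 1"
    using Suc by simp
  moreover have "real (pulls a i n \<omega>) \<le> B" if "a (Suc n) \<omega> = i"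
    using Suc.prems(2)[of "Suc n"] that by simp
  ultimately show ?case
    by (auto simp: pulls_Suc)
qed

text \<open>Ensures that a union bound over the sample sizes \<open>1..n\<close> covers all counts
  that occur.\<close>

lemma pulls_le_time: "pulls a i t \<omega> \<le> t"
proof (induction t)
  case (Suc t)
  then show ?case by (auto simp: pulls_Suc of_bool_def)
qed (simp add: pulls_def)

text \<open>The standard regret decomposition: rounds are grouped by the arm chosen.\<close>

lemma regret_eq_sum_pulls:
  assumes "\<And>t. t \<in> {1..n} \<Longrightarrow> a t \<omega> \<in> {1..K}"
  shows "regret f \<nu> istar a n \<omega> = (\<Sum>i\<in>{1..K}. real (pulls a i n \<omega>) * gap f \<nu> istar i)"
proof -
  have "regret f \<nu> istar a n \<omega> = (\<Sum>t=1..n. gap f \<nu> istar (a t \<omega>))"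
    by (simp add: regret_def gap_def sum_subtractf)
  also have "\<dots> = (\<Sum>t=1..n. \<Sum>i\<in>{1..K}. of_bool (a t \<omega> = i) * gap f \<nu> istar i)"
    using assms by (intro sum.cong) (auto simp: of_bool_def if_distrib[of "\<lambda>x. x * _"] sum.delta cong: if_cong)
  also have "\<dots> = (\<Sum>i\<in>{1..K}. \<Sum>t=1..n. of_bool (a t \<omega> = i) * gap f \<nu> istar i)"
    by (rule sum.swap)
  finally show ?thesis
    by (simp add: pulls_def sum_distrib_right)
qed

section \<open>Regret of the algorithm\<close>

text \<open>The witness \<open>z\<close> belongs to the set whose infimum is taken, and 0 bounds
  that set from below.\<close>

lemma phi_inv_bounds:
  assumes "0 \<le> z" "y \<le> \<phi> z"
  shows "0 \<le> phi_inv \<phi> y" "phi_inv \<phi> y \<le> z"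
  using assms unfolding phi_inv_def
  by (auto intro!: cInf_greatest cInf_lower bdd_belowI[of _ 0])

text \<open>The optimism argument at one sample point: \<open>i\<close> is the arm about to be
  chosen and \<open>j\<close> the best arm, with counts \<open>m\<close> and \<open>m'\<close>. The
  condition \<open>p\<close> excludes the real quotient by 0, whose value 0 would turn the bound
  into \<open>m = 0\<close>.\<close>

lemma pulls_before_choice_le:
  fixes m m' :: nat
  assumes \<phi>_mono: "strict_mono_on {0..} \<phi>"
    and f_\<phi>: "\<And>x1 x2. x1 \<in> {0..1} \<times> {0..1} \<Longrightarrow> x2 \<in> {0..1} \<times> {0..1} \<Longrightarrow>
               \<bar>f x2 - f x1\<bar> \<le> \<phi> (l1_norm (x2 - x1))"
    and \<delta>: "0 < \<delta>" "\<delta> < 1"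
    and X: "\<And>s. s \<in> {1..m} \<Longrightarrow> X i s \<omega> \<in> {0..1}"
    and X': "\<And>s. s \<in> {1..m'} \<Longrightarrow> X j s \<omega> \<in> {0..1}"
    and N: "arm_mean (\<nu> i) \<in> {0..1}" "arm_var (\<nu> i) \<in> {0..1}"
    and N': "arm_mean (\<nu> j) \<in> {0..1}" "arm_var (\<nu> j) \<in> {0..1}"
    and c: "m \<ge> 1 \<Longrightarrow> concentrated (conf_radius \<delta> m) X (\<nu> i) i m \<omega>"
    and c': "m' \<ge> 1 \<Longrightarrow> concentrated (conf_radius \<delta> m') X (\<nu> j) j m' \<omega>"
    and le: "lcb_index f \<phi> \<delta> X i m \<omega> \<le> lcb_index f \<phi> \<delta> X j m' \<omega>"
    and p: "phi_inv \<phi> (gap f \<nu> j i / 2) \<noteq> 0"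
  shows "real m \<le> 18 * ln (1 / \<delta>) / (phi_inv \<phi> (gap f \<nu> j i / 2))\<^sup>2"
proof (cases "m = 0")
  case True
  then show ?thesis using \<delta> by simp
next
  case False
  let ?p = "phi_inv \<phi> (gap f \<nu> j i / 2)" and ?r = "conf_radius \<delta>"
  \<comment> \<open>If \<open>j\<close> had not been pulled, its index would be
    \<open>- \<infinity>\<close>, below the finite index of \<open>i\<close>.\<close>
  have m: "m \<ge> 1" and m': "m' \<ge> 1"
    using False le by (auto simp: lcb_index_def not_less_eq_eq split: if_splits)
  have mono: "\<phi> x \<le> \<phi> y" if "0 \<le> x" "x \<le> y" for x y
    using that strict_mono_on_leD[OF \<phi>_mono, of x y] by simp
  have r: "0 \<le> ?r k" for k
    using \<delta> by (simp add: conf_radius_def)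
  have dev: "\<bar>f (emp_mean X l k \<omega>, emp_var X l k \<omega>) - arm_value f \<nu> l\<bar> \<le> \<phi> (3 * ?r k)"
    if "concentrated (?r k) X (\<nu> l) l k \<omega>" "k \<ge> 1" "\<And>s. s \<in> {1..k} \<Longrightarrow> X l s \<omega> \<in> {0..1}"
      "arm_mean (\<nu> l) \<in> {0..1}" "arm_var (\<nu> l) \<in> {0..1}" for l k
  proof -
    let ?e = "(emp_mean X l k \<omega>, emp_var X l k \<omega>)" and ?t = "(arm_mean (\<nu> l), arm_var (\<nu> l))"
    have "\<bar>f ?e - f ?t\<bar> \<le> \<phi> (l1_norm (?e - ?t))"
      using that emp_pair_in_unit[of k X l \<omega>] by (intro f_\<phi>) auto
    also have "\<dots> \<le> \<phi> (3 * ?r k)"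
      using l1_norm_emp_le[of "?r k" X "\<nu> l" l k \<omega>] that
      by (intro mono) (auto simp: l1_norm_def)
    finally show ?thesis
      by (simp add: arm_value_def)
  qed
  \<comment> \<open>For \<open>j\<close> the deviation \<open>\<phi> (3 * ?r m')\<close> is absorbed
    by the subtracted \<open>\<phi> (6 * ?r m')\<close>, so every term in \<open>m'\<close>
    disappears from the estimate of the gap.\<close>
  have "f (emp_mean X i m \<omega>, emp_var X i m \<omega>) - \<phi> (6 * ?r m)
      \<le> f (emp_mean X j m' \<omega>, emp_var X j m' \<omega>) - \<phi> (6 * ?r m')"
    using le m m' by (simp add: lcb_index_def conf_radius_def)
  moreover have "\<phi> (3 * ?r m) \<le> \<phi> (6 * ?r m)" "\<phi> (3 * ?r m') \<le> \<phi> (6 * ?r m')"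
    using r by (auto intro!: mono)
  moreover have "\<bar>f (emp_mean X i m \<omega>, emp_var X i m \<omega>) - arm_value f \<nu> i\<bar> \<le> \<phi> (3 * ?r m)"
    using dev[OF c[OF m] m _ N] X by blast
  moreover have "\<bar>f (emp_mean X j m' \<omega>, emp_var X j m' \<omega>) - arm_value f \<nu> j\<bar> \<le> \<phi> (3 * ?r m')"
    using dev[OF c'[OF m'] m' _ N'] X' by blast
  ultimately have "gap f \<nu> j i \<le> 2 * \<phi> (6 * ?r m)"
    unfolding gap_def by linarith
  then have "gap f \<nu> j i / 2 \<le> \<phi> (6 * ?r m)"
    by simp
  then have "0 \<le> ?p" "?p \<le> 6 * ?r m"
    using phi_inv_bounds[of "6 * ?r m" "gap f \<nu> j i / 2" \<phi>] r[of m] by auto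
  then have "?p\<^sup>2 \<le> (6 * ?r m)\<^sup>2"
    by (intro power_mono)
  \<comment> \<open>The constant is \<open>6\<^sup>2 / 2\<close>.\<close>
  also have "\<dots> = 18 * ln (1 / \<delta>) / real m"
    using \<delta> m by (simp add: conf_radius_def power_mult_distrib)
  finally show ?thesis
    using p m by (simp add: field_simps)
qed

text \<open>A statement about one sample point: arms of gap zero drop out, and every other arm
  contributes its gap times a pull bound from \<open>pulls_le\<close>.\<close>

lemma regret_le_of_pulls_le:
  assumes "\<And>t. t \<in> {1..n} \<Longrightarrow> a t \<omega> \<in> {1..K}"
    and nonneg: "\<And>i. i \<in> {1..K} \<Longrightarrow> gap f \<nu> istar i \<ge> 0"
    and B: "\<And>i t. i \<in> {1..K} \<Longrightarrow> t \<in> {1..n} \<Longrightarrow> a t \<omega> = i \<Longrightarrow> q i \<noteq> 0 \<Longrightarrow>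
              real (pulls a i (t - 1) \<omega>) \<le> c / (q i)\<^sup>2"
    and c: "c > 0"
  shows "ereal (regret f \<nu> istar a n \<omega>) \<le>
    (\<Sum>i\<in>{i\<in>{1..K}. gap f \<nu> istar i > 0}. ereal (gap f \<nu> istar i * c) / ereal ((q i)\<^sup>2)) +
    (\<Sum>i\<in>{i\<in>{1..K}. gap f \<nu> istar i > 0}. ereal (gap f \<nu> istar i))"
proof -
  let ?G = "gap f \<nu> istar" and ?I = "{i\<in>{1..K}. gap f \<nu> istar i > 0}"
  have "regret f \<nu> istar a n \<omega> = (\<Sum>i\<in>{1..K}. real (pulls a i n \<omega>) * ?G i)"
    using assms(1) by (rule regret_eq_sum_pulls)
  also have "\<dots> = (\<Sum>i\<in>?I. real (pulls a i n \<omega>) * ?G i)"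
    using nonneg by (intro sum.mono_neutral_right) (auto simp: order_less_le)
  finally have "ereal (regret f \<nu> istar a n \<omega>) = (\<Sum>i\<in>?I. ereal (real (pulls a i n \<omega>) * ?G i))"
    by simp
  also have "\<dots> \<le> (\<Sum>i\<in>?I. ereal (?G i * c) / ereal ((q i)\<^sup>2) + ereal (?G i))"
  proof (rule sum_mono)
    fix i assume i: "i \<in> ?I"
    show "ereal (real (pulls a i n \<omega>) * ?G i) \<le> ereal (?G i * c) / ereal ((q i)\<^sup>2) + ereal (?G i)"
    proof (cases "q i = 0")
      \<comment> \<open>A positive number divided by 0 is \<open>\<infinity>\<close> in
        \<open>ereal\<close>, so the bound for this arm is trivial.\<close>
      case True
      then show ?thesis using i c by simp
    next
      case False
      have "real (pulls a i n \<omega>) \<le> c / (q i)\<^sup>2 + 1"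
        using i c B False by (intro pulls_le) auto
      then have "real (pulls a i n \<omega>) * ?G i \<le> (c / (q i)\<^sup>2 + 1) * ?G i"
        using i by (intro mult_right_mono) auto
      also have "\<dots> = ?G i * c / (q i)\<^sup>2 + ?G i"
        by (simp add: algebra_simps)
      finally show ?thesis
        using False by simp
    qed
  qed
  also have "\<dots> = (\<Sum>i\<in>?I. ereal (?G i * c) / ereal ((q i)\<^sup>2)) + (\<Sum>i\<in>?I. ereal (?G i))"
    by (rule sum.distrib)
  finally show ?thesis .
qed

text \<open>Both parts of the theorem specialise this bound. Assuming \<open>\<delta> < 1\<close>
  makes \<open>ln (1 / \<delta>)\<close> positive; if \<open>4 * K * n * \<delta> \<ge> 1\<close>,
  the claim is void.\<close>

lemma phi_lcb_regret_bound:
  assumes M: "prob_space M"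
    and \<nu>: "\<And>i. i \<in> {1..K} \<Longrightarrow> real_distribution (\<nu> i)"
    and \<nu>_supp: "\<And>i. i \<in> {1..K} \<Longrightarrow> measure (\<nu> i) {0..1} = 1"
    and X_indep: "\<And>i. i \<in> {1..K} \<Longrightarrow> prob_space.indep_vars M (\<lambda>_. borel) (X i) {1..}"
    and X_distr: "\<And>i s. i \<in> {1..K} \<Longrightarrow> s \<ge> 1 \<Longrightarrow> distr M borel (X i s) = \<nu> i"
    and \<phi>_mono: "strict_mono_on {0..} \<phi>"
    and f_\<phi>: "\<And>x1 x2. x1 \<in> {0..1} \<times> {0..1} \<Longrightarrow> x2 \<in> {0..1} \<times> {0..1} \<Longrightarrow>
               \<bar>f x2 - f x1\<bar> \<le> \<phi> (l1_norm (x2 - x1))"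
    and istar: "is_arg_min (arm_value f \<nu>) (\<lambda>i. i \<in> {1..K}) istar"
    and \<delta>: "0 < \<delta>" "\<delta> < 1"
    and run: "phi_lcb_run M K n f \<phi> \<delta> X a"
  shows "\<P>(\<omega> in M. ereal (regret f \<nu> istar a n \<omega>)
                \<le> (\<Sum>i\<in>{i\<in>{1..K}. gap f \<nu> istar i > 0}.
                      ereal (gap f \<nu> istar i * (18 * ln (1 / \<delta>))) /
                      ereal ((phi_inv \<phi> (gap f \<nu> istar i / 2))\<^sup>2))
                  + (\<Sum>i\<in>{i\<in>{1..K}. gap f \<nu> istar i > 0}. ereal (gap f \<nu> istar i)))
            \<ge> 1 - 4 * real K * real n * \<delta>" (is "\<P>(\<omega> in M. ereal (?R \<omega>) \<le> ?U) \<ge> _")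
proof -
  interpret prob_space M by fact
  have unit_supp: "arm_mean (\<nu> i) \<in> {0..1}" "arm_var (\<nu> i) \<in> {0..1}" if "i \<in> {1..K}" for i
    using real_distribution.arm_mean_var_in_unit[OF \<nu>[OF that] \<nu>_supp[OF that]] by auto
  define bad where
    "bad i m = {\<omega> \<in> space M. \<not> concentrated (conf_radius \<delta> m) X (\<nu> i) i m \<omega>}" for i m
  \<comment> \<open>The union runs over deterministic sample sizes, not over the random counts,
    which depend on the samples. There are \<open>K * n\<close> events, each of probability at most
    \<open>4 * \<delta>\<close>.\<close>
  define B where "B = (\<Union>x\<in>{1..K} \<times> {1..n}. bad (fst x) (snd x))"
  have bad: "bad (fst x) (snd x) \<in> events" "prob (bad (fst x) (snd x)) \<le> 4 * \<delta>"
    if "x \<in> {1..K} \<times> {1..n}" for x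
  proof -
    have i: "fst x \<in> {1..K}" and m: "1 \<le> snd x"
      using that by auto
    note conc = prob_not_concentrated[where X = X, OF \<nu>[OF i] \<nu>_supp[OF i] X_indep[OF i] _ m \<delta>]
    show "bad (fst x) (snd x) \<in> events"
      unfolding bad_def by (rule conc(1)) (fact X_distr[OF i])
    show "prob (bad (fst x) (snd x)) \<le> 4 * \<delta>"
      unfolding bad_def by (rule conc(2)) (fact X_distr[OF i])
  qed
  have B_ev: "B \<in> events"
    unfolding B_def by (intro sets.finite_UN bad finite_cartesian_product finite_atLeastAtMost)
  have "prob B \<le> (\<Sum>x\<in>{1..K} \<times> {1..n}. prob (bad (fst x) (snd x)))"
    unfolding B_def by (intro measure_UNION_le bad finite_cartesian_product finite_atLeastAtMost)
  also have "\<dots> \<le> (\<Sum>x\<in>{1..K} \<times> {1..n}. 4 * \<delta>)"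
    by (intro sum_mono bad)
  also have "\<dots> = 4 * real K * real n * \<delta>"
    by simp
  finally have B: "prob B \<le> 4 * real K * real n * \<delta>" .
  have unit: "AE \<omega> in M. \<forall>i\<in>{1..K}. \<forall>s\<in>{1..n}. X i s \<omega> \<in> {0..1}"
    by (intro AE_finite_allI prob_not_concentrated(3)[OF \<nu> \<nu>_supp X_indep X_distr order_refl \<delta>]) auto

  have ms: "a t \<in> measurable M (count_space UNIV)" if "t \<in> {1..n}" for t
    using run that unfolding phi_lcb_run_def by blast
  have R_ms: "(\<lambda>\<omega>. ?R \<omega>) \<in> borel_measurable M"
    unfolding regret_def
    by (intro borel_measurable_diff borel_measurable_sum borel_measurable_const
        measurable_compose[OF ms]) auto
  have ev: "{\<omega> \<in> space M. ereal (?R \<omega>) \<le> ?U} \<in> events"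
    by (rule borel_measurable_le[OF borel_measurable_ereal[OF R_ms] borel_measurable_const])

  \<comment> \<open>From here on the argument is pathwise: no probability enters once
    \<open>\<omega>\<close> avoids \<open>B\<close> and its samples are in range.\<close>
  have det: "ereal (?R \<omega>) \<le> ?U"
    if \<omega>: "\<omega> \<in> space M" "\<omega> \<notin> B" and X: "\<forall>i\<in>{1..K}. \<forall>s\<in>{1..n}. X i s \<omega> \<in> {0..1}" for \<omega>
  proof (rule regret_le_of_pulls_le[where q = "\<lambda>i. phi_inv \<phi> (gap f \<nu> istar i / 2)"
        and c = "18 * ln (1 / \<delta>)"])
    have am: "is_arg_min (\<lambda>i. lcb_index f \<phi> \<delta> X i (pulls a i (t - 1) \<omega>) \<omega>) (\<lambda>i. i \<in> {1..K}) (a t \<omega>)"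
      if "t \<in> {1..n}" for t
      using run that \<omega> unfolding phi_lcb_run_def by blast
    show "a t \<omega> \<in> {1..K}" if "t \<in> {1..n}" for t
      using am[OF that] unfolding is_arg_min_def by blast
    have i: "istar \<in> {1..K}"
      using istar unfolding is_arg_min_def by blast
    show "gap f \<nu> istar i \<ge> 0" if "i \<in> {1..K}" for i
      using istar that unfolding is_arg_min_linorder gap_def by auto
    show "real (pulls a i (t - 1) \<omega>) \<le> 18 * ln (1 / \<delta>) / (phi_inv \<phi> (gap f \<nu> istar i / 2))\<^sup>2"
      if h: "i \<in> {1..K}" "t \<in> {1..n}" "a t \<omega> = i" "phi_inv \<phi> (gap f \<nu> istar i / 2) \<noteq> 0" for i t
    proof (rule pulls_before_choice_le[OF \<phi>_mono _ \<delta>, where X = X and \<omega> = \<omega>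
          and m' = "pulls a istar (t - 1) \<omega>"])
      have le: "pulls a j (t - 1) \<omega> \<le> n" for j
        using order_trans[OF pulls_le_time[of a j "t - 1" \<omega>], of n] h(2) by auto
      show "X i s \<omega> \<in> {0..1}" if "s \<in> {1..pulls a i (t - 1) \<omega>}" for s
        using X h(1) that le[of i] by auto
      show "X istar s \<omega> \<in> {0..1}" if "s \<in> {1..pulls a istar (t - 1) \<omega>}" for s
        using X i that le[of istar] by auto
      have c: "concentrated (conf_radius \<delta> m) X (\<nu> j) j m \<omega>" if "j \<in> {1..K}" "m \<in> {1..n}" for j m
        using \<omega> that unfolding B_def bad_def by auto
      show "concentrated (conf_radius \<delta> (pulls a i (t - 1) \<omega>)) X (\<nu> i) i (pulls a i (t - 1) \<omega>) \<omega>"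
        if "pulls a i (t - 1) \<omega> \<ge> 1"
        using c[OF h(1)] le[of i] that by auto
      show "concentrated (conf_radius \<delta> (pulls a istar (t - 1) \<omega>)) X (\<nu> istar) istar
          (pulls a istar (t - 1) \<omega>) \<omega>"
        if "pulls a istar (t - 1) \<omega> \<ge> 1"
        using c[OF i] le[of istar] that by auto
      show "lcb_index f \<phi> \<delta> X i (pulls a i (t - 1) \<omega>) \<omega>
          \<le> lcb_index f \<phi> \<delta> X istar (pulls a istar (t - 1) \<omega>) \<omega>"
        using am[OF h(2)] i h(3) unfolding is_arg_min_linorder by auto
    qed (fact f_\<phi> unit_supp[OF h(1)] unit_supp[OF i] h(4))+
  qed (simp_all add: \<delta>)

  have "1 - prob B = prob (space M - B)"
    using B_ev by (simp add: prob_compl)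
  also have "\<dots> \<le> \<P>(\<omega> in M. ereal (?R \<omega>) \<le> ?U)"
  proof (intro finite_measure_mono_AE ev)
    \<comment> \<open>The inclusion holds only up to the null set on which some sample leaves the
      unit interval.\<close>
    show "AE \<omega> in M. \<omega> \<in> space M - B \<longrightarrow> \<omega> \<in> {\<omega> \<in> space M. ereal (?R \<omega>) \<le> ?U}"
      using unit by eventually_elim (use det in blast)
  qed
  finally show ?thesis
    using B by linarith
qed

(* The bounds are ereal sums: phi_inv may be 0 if \<phi> jumps at 0, and c / 0 = \<infinity> in ereal for c > 0. *)
theorem theorem1:
  fixes M :: "'a measure"
    and K n istar :: nat
    and \<nu> :: "nat \<Rightarrow> real measure"
    and X :: "nat \<Rightarrow> nat \<Rightarrow> 'a \<Rightarrow> real"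
    and f :: "real \<times> real \<Rightarrow> real"
    and \<phi> :: "real \<Rightarrow> real"
    and \<Delta> :: "nat \<Rightarrow> real"
  assumes "K \<ge> 1" and "n \<ge> 1"
    and M: "prob_space M"
    and \<nu>: "\<And>i. i \<in> {1..K} \<Longrightarrow> real_distribution (\<nu> i)"
    and \<nu>_supp: "\<And>i. i \<in> {1..K} \<Longrightarrow> measure (\<nu> i) {0..1} = 1"
    and X_indep: "\<And>i. i \<in> {1..K} \<Longrightarrow> prob_space.indep_vars M (\<lambda>_. borel) (X i) {1..}"
    and X_distr: "\<And>i s. i \<in> {1..K} \<Longrightarrow> s \<ge> 1 \<Longrightarrow> distr M borel (X i s) = \<nu> i"
    and f_cont: "continuous_on ({0..1} \<times> {0..1}) f"
    and \<phi>_nonneg: "\<phi> \<in> {0..} \<rightarrow> {0..}"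
    and \<phi>_mono: "strict_mono_on {0..} \<phi>"
    and \<phi>_zero: "\<phi> 0 = 0"
    and f_\<phi>: "\<And>x1 x2. x1 \<in> {0..1} \<times> {0..1} \<Longrightarrow> x2 \<in> {0..1} \<times> {0..1} \<Longrightarrow>
               \<bar>f x2 - f x1\<bar> \<le> \<phi> (l1_norm (x2 - x1))"
    and istar: "is_arg_min (arm_value f \<nu>) (\<lambda>i. i \<in> {1..K}) istar"
    and \<Delta>: "\<And>i. \<Delta> i = gap f \<nu> istar i"
  shows "(\<forall>\<delta> a. 0 < \<delta> \<and> \<delta> < 1 / (4 * real K * real n) \<and> phi_lcb_run M K n f \<phi> \<delta> X a \<longrightarrow>
            \<P>(\<omega> in M. ereal (regret f \<nu> istar a n \<omega>)
                \<le> (\<Sum>i\<in>{i\<in>{1..K}. \<Delta> i > 0}.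
                      ereal (18 * \<Delta> i * ln (1 / \<delta>)) / ereal ((phi_inv \<phi> (\<Delta> i / 2))\<^sup>2))
                  + (\<Sum>i\<in>{i\<in>{1..K}. \<Delta> i > 0}. ereal (\<Delta> i)))
            \<ge> 1 - 4 * real K * real n * \<delta>)
       \<and> (n > 4 * K \<longrightarrow>
           (\<forall>a. phi_lcb_run M K n f \<phi> (1 / (real n)\<^sup>2) X a \<longrightarrow>
            \<P>(\<omega> in M. ereal (regret f \<nu> istar a n \<omega>)
                \<le> (\<Sum>i\<in>{i\<in>{1..K}. \<Delta> i > 0}.
                      ereal (36 * \<Delta> i) / ereal ((phi_inv \<phi> (\<Delta> i / 2))\<^sup>2) * ereal (ln (real n)))
                  + (\<Sum>i\<in>{i\<in>{1..K}. \<Delta> i > 0}. ereal (\<Delta> i)))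
            \<ge> 1 - 4 * real K / real n))"
proof -
  have \<Delta>_eq: "\<Delta> = gap f \<nu> istar"
    using \<Delta> by blast
  have bound: "\<P>(\<omega> in M. ereal (regret f \<nu> istar a n \<omega>)
                \<le> (\<Sum>i\<in>{i\<in>{1..K}. \<Delta> i > 0}.
                      ereal (\<Delta> i * (18 * ln (1 / \<delta>))) / ereal ((phi_inv \<phi> (\<Delta> i / 2))\<^sup>2))
                  + (\<Sum>i\<in>{i\<in>{1..K}. \<Delta> i > 0}. ereal (\<Delta> i)))
            \<ge> 1 - 4 * real K * real n * \<delta>"
    if "0 < \<delta>" "\<delta> < 1" "phi_lcb_run M K n f \<phi> \<delta> X a" for \<delta> a
    unfolding \<Delta>_eq by (rule phi_lcb_regret_bound) fact+
  show ?thesis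
  proof (intro conjI impI allI; (elim conjE)?)
    fix \<delta> a
    assume \<delta>: "0 < \<delta>" "\<delta> < 1 / (4 * real K * real n)" and run: "phi_lcb_run M K n f \<phi> \<delta> X a"
    have "1 \<le> real K * real n"
      using assms(1,2) mult_mono[of 1 "real K" 1 "real n"] by simp
    then have "1 / (4 * real K * real n) \<le> 1"
      by (subst divide_le_eq_1) linarith
    then have "\<delta> < 1"
      using \<delta> by linarith
    have eq: "18 * \<Delta> i * ln (1 / \<delta>) = \<Delta> i * (18 * ln (1 / \<delta>))" for i
      by simp
    from bound[OF \<delta>(1) \<open>\<delta> < 1\<close> run]
    show "\<P>(\<omega> in M. ereal (regret f \<nu> istar a n \<omega>)
                \<le> (\<Sum>i\<in>{i\<in>{1..K}. \<Delta> i > 0}.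
                      ereal (18 * \<Delta> i * ln (1 / \<delta>)) / ereal ((phi_inv \<phi> (\<Delta> i / 2))\<^sup>2))
                  + (\<Sum>i\<in>{i\<in>{1..K}. \<Delta> i > 0}. ereal (\<Delta> i)))
            \<ge> 1 - 4 * real K * real n * \<delta>"
      unfolding eq .
  next
    fix a
    assume n: "n > 4 * K" and run: "phi_lcb_run M K n f \<phi> (1 / (real n)\<^sup>2) X a"
    have n4: "real n > 1"
      using n assms(1) by simp
    have L: "ln (1 / (1 / (real n)\<^sup>2)) = 2 * ln (real n)"
      using n4 by (simp add: ln_realpow)
    \<comment> \<open>If \<open>phi_inv\<close> is 0, both sides are \<open>\<infinity>\<close>; on
      the right this uses \<open>ln (real n) > 0\<close>. Otherwise the factor 2 from
      \<open>L\<close> turns 18 into 36.\<close>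
    have term_eq: "ereal (\<Delta> i * (18 * ln (1 / (1 / (real n)\<^sup>2)))) / ereal ((phi_inv \<phi> (\<Delta> i / 2))\<^sup>2)
        = ereal (36 * \<Delta> i) / ereal ((phi_inv \<phi> (\<Delta> i / 2))\<^sup>2) * ereal (ln (real n))"
      if "\<Delta> i > 0" for i
      using that n4 unfolding L by (cases "phi_inv \<phi> (\<Delta> i / 2) = 0") auto
    have sum_eq: "(\<Sum>i\<in>{i\<in>{1..K}. \<Delta> i > 0}.
          ereal (\<Delta> i * (18 * ln (1 / (1 / (real n)\<^sup>2)))) / ereal ((phi_inv \<phi> (\<Delta> i / 2))\<^sup>2))
        = (\<Sum>i\<in>{i\<in>{1..K}. \<Delta> i > 0}.
          ereal (36 * \<Delta> i) / ereal ((phi_inv \<phi> (\<Delta> i / 2))\<^sup>2) * ereal (ln (real n)))"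
      by (intro sum.cong refl term_eq) auto
    have "0 < 1 / (real n)\<^sup>2" "1 / (real n)\<^sup>2 < 1"
      using n4 by (auto simp: divide_less_eq_1 one_less_power)
    from bound[OF this run]
    have "\<P>(\<omega> in M. ereal (regret f \<nu> istar a n \<omega>)
                \<le> (\<Sum>i\<in>{i\<in>{1..K}. \<Delta> i > 0}.
                      ereal (36 * \<Delta> i) / ereal ((phi_inv \<phi> (\<Delta> i / 2))\<^sup>2) * ereal (ln (real n)))
                  + (\<Sum>i\<in>{i\<in>{1..K}. \<Delta> i > 0}. ereal (\<Delta> i)))
            \<ge> 1 - 4 * real K * real n * (1 / (real n)\<^sup>2)"
      unfolding sum_eq .
    also have "4 * real K * real n * (1 / (real n)\<^sup>2) = 4 * real K / real n"
      by (simp add: power2_eq_square)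
    finally show "\<P>(\<omega> in M. ereal (regret f \<nu> istar a n \<omega>)
                \<le> (\<Sum>i\<in>{i\<in>{1..K}. \<Delta> i > 0}.
                      ereal (36 * \<Delta> i) / ereal ((phi_inv \<phi> (\<Delta> i / 2))\<^sup>2) * ereal (ln (real n)))
                  + (\<Sum>i\<in>{i\<in>{1..K}. \<Delta> i > 0}. ereal (\<Delta> i)))
            \<ge> 1 - 4 * real K / real n" .
  qed
qed

end
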